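(* Let $K\subset\mathbb{R}^n$ be a convex body in Löwner position and assume that $S^{n-1}\cap\partial K=\{\xi_1,\ldots,\xi_m\}$ is finite. Let $F:\mathbb{R}\to\mathbb{R}$ be any $C^1$ function that is non-negative, non-decreasing, convex, strictly convex in $[0,\infty)$, and satisfies $F'(0)>0$. Consider the convex functional $I_c:\mathrm{Sym}\times\mathbb{R}^n\to\mathbb{R}$ defined by $$I_c(M,w)=\sum_{i=1}^m F(\langle \xi_i,M\xi_i+w\rangle).$$ If the restriction of $I_c$ to $\mathrm{Sym}_0\times\mathbb{R}^n$ has a unique global minimum $(M_0,w_0)$, then the numbers $$c_i=F'(\langle\xi_i,M_0\xi_i+w_0\rangle),\quad i=1,\ldots,m,$$ together with the vectors $\xi_i$, $i=1,\dots,m$, satisfy $$\sum_{i=1}^m c_i\,\xi_i\otimes\xi_i=\lambda\,\mathrm{Id}\quad\text{and}\quad \sum_{i=1}^m c_i\xi_i=0$$ for some $\lambda\neq0$.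
   Context: A convex body is a compact convex subset of $\mathbb{R}^n$ with non-empty interior. $\mathbb{B}$ is the closed unit Euclidean ball of $\mathbb{R}^n$ and $S^{n-1}$ its boundary. A convex body $K$ is in Löwner position if $\mathbb{B}$ is the (unique) ellipsoid of minimal volume containing $K$. $\mathrm{Sym}$ is the space of real symmetric $n\times n$ matrices and $\mathrm{Sym}_0=\{A\in\mathrm{Sym}: \mathrm{tr}(A)=0\}$. For vectors $v,w$, $v\otimes w$ is the matrix $(v\otimes w)_{i,j}=v_iw_j$. The points $\xi_1,\dots,\xi_m$ are distinct. *)

theory Defs
  imports "HOL-Analysis.Analysis"
begin

definition convex_body :: "(real ^ 'n) set \<Rightarrow> bool" where
  "convex_body K \<longleftrightarrow> compact K \<and> convex K \<and> interior K \<noteq> {}"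

definition ellipsoid :: "(real ^ 'n) set \<Rightarrow> bool" where
  "ellipsoid E \<longleftrightarrow>
    (\<exists>(A :: real ^ 'n ^ 'n) b. invertible A \<and> E = (\<lambda>x. A *v x + b) ` cball 0 1)"

definition unique_global_min_on :: "('a \<Rightarrow> real) \<Rightarrow> 'a set \<Rightarrow> 'a \<Rightarrow> bool" where
  "unique_global_min_on f S x \<longleftrightarrow> (\<forall>y. is_arg_min f (\<lambda>z. z \<in> S) y \<longleftrightarrow> y = x)"

definition loewner_position :: "(real ^ 'n) set \<Rightarrow> bool" where
  "loewner_position K \<longleftrightarrow>
    unique_global_min_on (measure lebesgue) {E. ellipsoid E \<and> K \<subseteq> E} (cball 0 1)"

definition Sym :: "(real ^ 'n ^ 'n) set" where
  "Sym = {A. transpose A = A}"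

definition Sym0 :: "(real ^ 'n ^ 'n) set" where
  "Sym0 = {A \<in> Sym. trace A = 0}"

definition outer_product :: "real ^ 'n \<Rightarrow> real ^ 'n \<Rightarrow> real ^ 'n ^ 'n" where
  "outer_product v w = (\<chi> i j. v $ i * w $ j)"

definition strictly_convex_on :: "'a::real_vector set \<Rightarrow> ('a \<Rightarrow> real) \<Rightarrow> bool" where
  "strictly_convex_on S f \<longleftrightarrow> convex S \<and>
    (\<forall>x\<in>S. \<forall>y\<in>S. x \<noteq> y \<longrightarrow>
      (\<forall>u>0. \<forall>v>0. u + v = 1 \<longrightarrow> f (u *\<^sub>R x + v *\<^sub>R y) < u * f x + v * f y))"

text \<open>The functional is meant on \<open>Sym \<times> UNIV\<close>; the type alone does not enforce symmetry,
  so minimisation has to be stated relative to an explicit domain.\<close>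

definition contact_functional ::
    "(real \<Rightarrow> real) \<Rightarrow> (nat \<Rightarrow> real ^ 'n) \<Rightarrow> nat \<Rightarrow> (real ^ 'n ^ 'n) \<times> (real ^ 'n) \<Rightarrow> real" where
  "contact_functional F \<xi> m = (\<lambda>(M, w). \<Sum>i=1..m. F (\<xi> i \<bullet> (M *v \<xi> i + w)))"

lemma convex_Sym: "convex (Sym :: (real ^ 'n ^ 'n) set)"
  by (auto simp: convex_def Sym_def transpose_def vec_eq_iff)

lemma convex_on_contact_functional:
  fixes \<xi> :: "nat \<Rightarrow> real ^ 'n"
  assumes F: "convex_on UNIV F"
  shows "convex_on (Sym \<times> UNIV) (contact_functional F \<xi> m)"
proof -
  have conv: "convex (Sym \<times> UNIV :: ((real ^ 'n ^ 'n) \<times> (real ^ 'n)) set)"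
    by (intro convex_Times convex_Sym convex_UNIV)
  have lin: "\<xi> i \<bullet> ((u *\<^sub>R M + v *\<^sub>R N) *v \<xi> i + (u *\<^sub>R w + v *\<^sub>R z))
      = u *\<^sub>R (\<xi> i \<bullet> (M *v \<xi> i + w)) + v *\<^sub>R (\<xi> i \<bullet> (N *v \<xi> i + z))"
    for i u v M N w z
    by (simp add: matrix_vector_mult_add_rdistrib scaleR_matrix_vector_assoc [symmetric]
        inner_add_right algebra_simps)
  have "F (\<xi> i \<bullet> ((u *\<^sub>R M + v *\<^sub>R N) *v \<xi> i + (u *\<^sub>R w + v *\<^sub>R z)))
      \<le> u * F (\<xi> i \<bullet> (M *v \<xi> i + w)) + v * F (\<xi> i \<bullet> (N *v \<xi> i + z))"
    if "u \<ge> 0" "v \<ge> 0" "u + v = 1" for i u v M N w z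
    unfolding lin using F that by (auto simp: convex_on_def)
  then show ?thesis
    using conv
    by (auto simp: convex_on_def contact_functional_def sum_distrib_left
        simp flip: sum.distrib intro!: sum_mono)
qed

end

theory Submission
  imports Defs
begin

text \<open>The two identities are the Euler--Lagrange equations of the constrained minimum.
  Since \<open>Sym0 \<times> UNIV\<close> is a linear subspace, the derivative of the functional at \<open>(M0, w0)\<close>
  vanishes in every direction \<open>(N, v)\<close> of it, which reads
  \<open>(\<Sum>i. c i * (\<xi> i \<bullet> (N *v \<xi> i + v))) = 0\<close>
  (\<open>contact_functional_stationary\<close>). Directions \<open>(0, v)\<close> give \<open>(\<Sum>i. c i *\<^sub>R \<xi> i) = 0\<close>. As
  \<open>\<xi> i \<bullet> (N *v \<xi> i)\<close> is the Frobenius inner product of \<open>outer_product (\<xi> i) (\<xi> i)\<close> with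
  \<open>N\<close>, directions \<open>(N, 0)\<close> say that the symmetric matrix \<open>A = (\<Sum>i. c i *\<^sub>R
  outer_product (\<xi> i) (\<xi> i))\<close> is orthogonal to all traceless symmetric matrices, so \<open>A\<close> is a
  multiple of the identity (\<open>orthogonal_to_Sym0_imp_scalar\<close>).

  The factor is nonzero because of uniqueness. The \<open>\<xi> i\<close> are unit vectors, so the trace of
  \<open>A\<close> is \<open>\<Sum>i. c i\<close>, and the \<open>c i\<close> are nonnegative because \<open>F\<close> is monotone. If the factor
  were zero, all \<open>c i\<close> would vanish, and by convexity \<open>F\<close> would attain its minimum over the
  line at every argument \<open>\<xi> i \<bullet> (M0 *v \<xi> i + w0)\<close>. These arguments would all be negative, since
  \<open>deriv F 0 > 0\<close> and \<open>F\<close> is monotone. Doubling \<open>(M0, w0)\<close> then moves each of them further to the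
  left, where \<open>F\<close> is no larger, and produces a second minimiser
  (\<open>unique_min_imp_deriv_nonzero\<close>).\<close>

section \<open>Frobenius duality for traceless symmetric matrices\<close>

lemma inner_matrix_vector_mult_eq_inner_outer_product:
  fixes x y :: "real ^ 'n"
  shows "x \<bullet> (N *v y) = outer_product x y \<bullet> N"
  by (simp add: inner_vec_def matrix_vector_mult_def outer_product_def sum_distrib_left
      mult.assoc mult.left_commute mult.commute)

lemma trace_outer_product: "trace (outer_product x y) = x \<bullet> y"
  by (simp add: trace_def outer_product_def inner_vec_def)

lemma inner_mat_1: "(N :: real ^ 'n ^ 'n) \<bullet> mat 1 = trace N"
  by (simp add: inner_vec_def mat_def trace_def if_distrib cong: if_cong)

lemma outer_product_self_in_Sym: "outer_product x x \<in> Sym"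
  by (simp add: Sym_def outer_product_def transpose_def vec_eq_iff mult.commute)

lemma subspace_Sym: "subspace (Sym :: (real ^ 'n ^ 'n) set)"
  by (auto simp: subspace_def Sym_def transpose_def vec_eq_iff)

lemma subspace_Sym0: "subspace (Sym0 :: (real ^ 'n ^ 'n) set)"
  using subspace_Sym
  by (auto simp: subspace_def Sym0_def inner_add_left simp flip: inner_mat_1)

text \<open>The traceless part of \<open>A\<close> lies in \<open>Sym0\<close> and is orthogonal both to \<open>A\<close> and to the
  identity, hence to itself.\<close>

lemma orthogonal_to_Sym0_imp_scalar:
  fixes A :: "real ^ 'n ^ 'n"
  assumes "A \<in> Sym" and orth: "\<And>N. N \<in> Sym0 \<Longrightarrow> A \<bullet> N = 0"
  shows "A = (trace A / real CARD('n)) *\<^sub>R mat 1"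
proof -
  define l where "l = trace A / real CARD('n)"
  define N where "N = A - l *\<^sub>R mat 1"
  have "(mat 1 :: real ^ 'n ^ 'n) \<in> Sym"
    by (simp add: Sym_def)
  then have "N \<in> Sym"
    unfolding N_def using assms(1) subspace_Sym by (intro subspace_diff subspace_scale)
  moreover have trN: "trace N = 0"
    by (simp add: N_def l_def trace_sub trace_I inner_diff_left flip: inner_mat_1)
      (simp add: inner_mat_1 trace_I)
  ultimately have "A \<bullet> N = 0"
    by (intro orth) (simp add: Sym0_def)
  moreover have "N \<bullet> N = A \<bullet> N - l * trace N"
    using inner_diff_left[of A "l *\<^sub>R mat 1" N] inner_mat_1[of N]
    by (simp add: N_def [symmetric] inner_commute[of "mat 1" N])
  ultimately have "N \<bullet> N = 0"
    using trN by simp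
  then show ?thesis
    by (simp add: N_def l_def)
qed

section \<open>Stationarity at a minimum\<close>

lemma contact_functional_has_derivative_along_line:
  assumes "\<And>x. F field_differentiable (at x)"
  shows "((\<lambda>s. contact_functional F \<xi> m (M + s *\<^sub>R N, w + s *\<^sub>R v)) has_real_derivative
    (\<Sum>i=1..m. deriv F (\<xi> i \<bullet> (M *v \<xi> i + w)) * (\<xi> i \<bullet> (N *v \<xi> i + v)))) (at 0)"
proof -
  have line: "\<xi> i \<bullet> ((M + s *\<^sub>R N) *v \<xi> i + (w + s *\<^sub>R v))
      = \<xi> i \<bullet> (M *v \<xi> i + w) + s * (\<xi> i \<bullet> (N *v \<xi> i + v))" for i s
    by (simp add: matrix_vector_mult_add_rdistrib scaleR_matrix_vector_assoc [symmetric]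
        inner_add_right algebra_simps)
  have "((\<lambda>s. F (a + s * b)) has_real_derivative deriv F a * b) (at 0)" for a b
  proof -
    have "(F has_real_derivative deriv F a) (at (a + 0 * b))"
      using assms by (simp add: DERIV_deriv_iff_field_differentiable)
    moreover have "((\<lambda>s. a + s * b) has_real_derivative b) (at 0)"
      by (auto intro!: derivative_eq_intros)
    ultimately show ?thesis
      by (rule DERIV_chain2)
  qed
  then show ?thesis
    unfolding contact_functional_def prod.case line by (intro DERIV_sum)
qed

lemma contact_functional_stationary:
  assumes "\<And>x. F field_differentiable (at x)"
    and V: "subspace V" "(M, w) \<in> V" "(N, v) \<in> V"
    and min: "\<And>y. y \<in> V \<Longrightarrow> contact_functional F \<xi> m (M, w) \<le> contact_functional F \<xi> m y"
  shows "(\<Sum>i=1..m. deriv F (\<xi> i \<bullet> (M *v \<xi> i + w)) * (\<xi> i \<bullet> (N *v \<xi> i + v))) = 0"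
proof (rule DERIV_local_min[OF contact_functional_has_derivative_along_line zero_less_one])
  have "(M + s *\<^sub>R N, w + s *\<^sub>R v) \<in> V" for s
    using subspace_add[OF V(1,2) subspace_scale[OF V(1,3)], of s] by simp
  then show "\<forall>s. \<bar>0 - s\<bar> < 1 \<longrightarrow>
      contact_functional F \<xi> m (M + 0 *\<^sub>R N, w + 0 *\<^sub>R v)
        \<le> contact_functional F \<xi> m (M + s *\<^sub>R N, w + s *\<^sub>R v)"
    using min by simp
qed (use assms in auto)

section \<open>Non-degeneracy of the multipliers\<close>

lemma convex_stationary_imp_global_min:
  fixes F :: "real \<Rightarrow> real"
  assumes "convex_on UNIV F" "F field_differentiable (at t)" "deriv F t = 0"
  shows "F t \<le> F x"
proof -
  have "(F has_real_derivative 0) (at t)"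
    using assms(2,3) by (metis DERIV_deriv_iff_field_differentiable)
  then show ?thesis
    using convex_on_imp_above_tangent[OF assms(1), of t x 0] by simp
qed

text \<open>At a nonnegative minimum point monotonicity would make \<open>0\<close> a minimum point as well,
  and the derivative there would vanish.\<close>

lemma mono_global_min_imp_negative:
  fixes F :: "real \<Rightarrow> real"
  assumes "mono F" "F field_differentiable (at 0)" "deriv F 0 > 0"
    and min: "\<And>x. F t \<le> F x"
  shows "t < 0"
proof (rule ccontr)
  assume "\<not> t < 0"
  then have "F 0 \<le> F t"
    using \<open>mono F\<close> by (simp add: monoD)
  then have "F 0 \<le> F x" for x
    using min order_trans by blast
  moreover have "(F has_real_derivative deriv F 0) (at 0)"
    using assms(2) by (simp add: DERIV_deriv_iff_field_differentiable)
  ultimately have "deriv F 0 = 0"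
    by (intro DERIV_local_min[of F "deriv F 0" 0 1]) auto
  with assms(3) show False by simp
qed

text \<open>If all these derivatives vanish, every \<open>F\<close>-argument at the minimiser is negative and
  doubling the minimiser does not increase the functional, so by uniqueness the minimiser is
  \<open>(0, 0)\<close>, where every argument is \<open>0\<close>. The case \<open>m = 0\<close> has no argument to contradict this;
  there the functional is constant on a nontrivial space.\<close>

lemma unique_min_imp_deriv_nonzero:
  fixes \<xi> :: "nat \<Rightarrow> real ^ 'n"
  assumes diff: "\<And>x. F field_differentiable (at x)"
    and "mono F" "convex_on UNIV F" "deriv F 0 > 0"
    and uniq: "unique_global_min_on (contact_functional F \<xi> m) (Sym0 \<times> UNIV) (M, w)"
  shows "\<exists>i\<in>{1..m}. deriv F (\<xi> i \<bullet> (M *v \<xi> i + w)) \<noteq> 0"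
proof (rule ccontr)
  define t where "t i = \<xi> i \<bullet> (M *v \<xi> i + w)" for i
  assume "\<not> ?thesis"
  then have stat: "deriv F (t i) = 0" if "i \<in> {1..m}" for i
    using that by (auto simp: t_def)
  have min: "F (t i) \<le> F x" if "i \<in> {1..m}" for i x
    using convex_stationary_imp_global_min[OF assms(3) diff stat[OF that]] .
  have neg: "t i < 0" if "i \<in> {1..m}" for i
    using mono_global_min_imp_negative[OF assms(2) diff assms(4) min[OF that]] .
  have M: "M \<in> Sym0"
    using uniq by (auto simp: unique_global_min_on_def is_arg_min_def)
  have val: "contact_functional F \<xi> m (M, w) = (\<Sum>i=1..m. F (t i))"
    by (simp add: contact_functional_def t_def)
  have no_other: "y = (M, w)"
    if "y \<in> Sym0 \<times> UNIV" "contact_functional F \<xi> m y \<le> contact_functional F \<xi> m (M, w)" for y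
  proof -
    have "is_arg_min (contact_functional F \<xi> m) (\<lambda>z. z \<in> Sym0 \<times> UNIV) (M, w)"
      using uniq unfolding unique_global_min_on_def by blast
    then have "is_arg_min (contact_functional F \<xi> m) (\<lambda>z. z \<in> Sym0 \<times> UNIV) y"
      unfolding is_arg_min_linorder using that order_trans by blast
    then show ?thesis
      using uniq unfolding unique_global_min_on_def by blast
  qed
  show False
  proof (cases "m = 0")
    case True
    then have "(M, w + 1) = (M, w)"
      using M by (intro no_other) (auto simp: contact_functional_def)
    then show False by simp
  next
    case False
    have "2 *\<^sub>R M \<in> Sym0"
      using M subspace_Sym0 by (rule subspace_scale[rotated])
    moreover have "contact_functional F \<xi> m (2 *\<^sub>R M, 2 *\<^sub>R w) = (\<Sum>i=1..m. F (2 * t i))"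
      by (simp add: contact_functional_def t_def inner_add_right
          scaleR_matrix_vector_assoc [symmetric] algebra_simps)
    moreover have "(\<Sum>i=1..m. F (2 * t i)) \<le> (\<Sum>i=1..m. F (t i))"
      using neg \<open>mono F\<close> by (intro sum_mono monoD[of F]) fastforce+
    ultimately have "(2 *\<^sub>R M, 2 *\<^sub>R w) = (M, w)"
      using val by (intro no_other) auto
    then have "M = 0" "w = 0"
      by (simp_all add: scaleR_2)
    then have "t 1 = 0"
      by (simp add: t_def)
    with neg[of 1] False show False by simp
  qed
qed

section \<open>The decomposition of the identity\<close>

theorem corollary4:
  fixes K :: "(real ^ 'n) set"
    and \<xi> :: "nat \<Rightarrow> real ^ 'n"
    and m :: nat
    and F :: "real \<Rightarrow> real"
    and M0 :: "real ^ 'n ^ 'n"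
    and w0 :: "real ^ 'n"
    and c :: "nat \<Rightarrow> real"
  assumes "convex_body K"
    and "loewner_position K"
    and "inj_on \<xi> {1..m}"
    and "sphere 0 1 \<inter> frontier K = \<xi> ` {1..m}"
    and "F C1_differentiable_on UNIV"
    and "\<forall>x. F x \<ge> 0"
    and "mono F"
    and "convex_on UNIV F"
    and "strictly_convex_on {0..} F"
    and "deriv F 0 > 0"
    and "unique_global_min_on (contact_functional F \<xi> m) (Sym0 \<times> UNIV) (M0, w0)"
    and "\<forall>i\<in>{1..m}. c i = deriv F (\<xi> i \<bullet> (M0 *v \<xi> i + w0))"
  shows "\<exists>l::real. l \<noteq> 0 \<and>
    (\<Sum>i=1..m. c i *\<^sub>R outer_product (\<xi> i) (\<xi> i)) = l *\<^sub>R mat 1 \<and>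
    (\<Sum>i=1..m. c i *\<^sub>R \<xi> i) = 0"
proof -
  note uniq = assms(11)
  define A where "A = (\<Sum>i=1..m. c i *\<^sub>R outer_product (\<xi> i) (\<xi> i))"
  have diff: "F field_differentiable (at x)" for x
    using assms(5)
    by (auto simp: C1_differentiable_on_def field_differentiable_def
        has_real_derivative_iff_has_vector_derivative)
  have c: "c i = deriv F (\<xi> i \<bullet> (M0 *v \<xi> i + w0))" if "i \<in> {1..m}" for i
    using assms(12) that by blast
  have M0: "M0 \<in> Sym0"
    using uniq by (auto simp: unique_global_min_on_def is_arg_min_def)
  have min: "contact_functional F \<xi> m (M0, w0) \<le> contact_functional F \<xi> m y"
    if "y \<in> Sym0 \<times> UNIV" for y
    using uniq that by (auto simp: unique_global_min_on_def is_arg_min_linorder)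
  have V: "subspace (Sym0 \<times> UNIV :: ((real ^ 'n ^ 'n) \<times> (real ^ 'n)) set)"
    by (intro subspace_Times subspace_Sym0 subspace_UNIV)
  have stationary: "(\<Sum>i=1..m. c i * (\<xi> i \<bullet> (N *v \<xi> i + v))) = 0" if "N \<in> Sym0" for N v
    using contact_functional_stationary[OF diff V _ _ min, of N v] M0 that c by simp
  have "(\<Sum>i=1..m. c i *\<^sub>R \<xi> i) \<bullet> v = 0" for v
    using stationary[OF subspace_0[OF subspace_Sym0], of v] by (simp add: inner_sum_left)
  then have centred: "(\<Sum>i=1..m. c i *\<^sub>R \<xi> i) = 0"
    using inner_eq_zero_iff by blast
  have "A \<in> Sym"
    unfolding A_def
    by (intro subspace_sum subspace_scale subspace_Sym outer_product_self_in_Sym)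
  moreover have "A \<bullet> N = 0" if "N \<in> Sym0" for N
    using stationary[OF that, of 0]
    by (simp add: A_def inner_sum_left inner_matrix_vector_mult_eq_inner_outer_product)
  ultimately have A: "A = (trace A / real CARD('n)) *\<^sub>R mat 1"
    by (rule orthogonal_to_Sym0_imp_scalar)
  have "\<xi> i \<bullet> \<xi> i = 1" if "i \<in> {1..m}" for i
  proof -
    have "\<xi> i \<in> sphere 0 1"
      using assms(4) that by blast
    then show ?thesis
      by (simp add: dot_square_norm)
  qed
  then have trA: "trace A = (\<Sum>i=1..m. c i)"
    unfolding inner_mat_1 [symmetric] A_def inner_sum_left inner_scaleR_left
    unfolding inner_mat_1 trace_outer_product by simp
  have nonneg: "c i \<ge> 0" if "i \<in> {1..m}" for i
    unfolding c[OF that]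
    by (rule mono_on_imp_deriv_nonneg[OF assms(7),
          where x = "\<xi> i \<bullet> (M0 *v \<xi> i + w0)"])
      (auto simp: DERIV_deriv_iff_field_differentiable intro: diff)
  obtain j where "j \<in> {1..m}" "c j \<noteq> 0"
    using unique_min_imp_deriv_nonzero[OF diff assms(7,8,10) uniq] c by auto
  then have "(\<Sum>i=1..m. c i) > 0"
    using nonneg by (intro sum_pos2[of _ j]) (auto simp: less_le)
  then have "trace A / real CARD('n) \<noteq> 0"
    using trA by simp
  with A centred show ?thesis
    unfolding A_def by blast
qed

end
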